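(* Let $R=K[x_1,\dots,x_n]$ be a polynomial ring over a field $K$. The Newton polytope of a principal Borel symmetric strongly shifted ideal is a permutohedron: for $\lambda\in P_n$, $$\mathrm{np}(\mathrm{Sss}(\{\lambda\}))=\mathbf P(\lambda)=\mathrm{conv}\{\sigma(\lambda):\sigma\in\mathfrak S_n\}.$$ In general, the Newton polytope of a symmetric strongly shifted ideal $I$ is a convex hull of a union of permutohedra: $$\mathrm{np}(I)=\mathrm{conv}\Big(\bigcup_{\lambda\in B(I)}\mathbf P(\lambda)\Big).$$
   Context: $\mathfrak S_n$ acts on $R$ by permuting variables and on $\mathbb R^n$ by permuting coordinates. $P_n=\{\lambda\in\mathbb Z^n: 0\le\lambda_1\le\cdots\le\lambda_n\}$, $x^\lambda=x_1^{\lambda_1}\cdots x_n^{\lambda_n}$. For an $\mathfrak S_n$-fixed monomial ideal $I$ put $P(I)=\{\lambda\in P_n: x^\lambda\in I\}$. An $\mathfrak S_n$-fixed monomial ideal $I$ is symmetric strongly shifted if for every $\lambda\in P(I)$ and $1\le i<j\le n$ with $\lambda_i<\lambda_j$ one has $x^\lambda x_i/x_j\in I$. For $B\subseteq P_n$, $\mathrm{Sss}(B)$ is the smallest symmetric strongly shifted ideal containing $\{x^\lambda:\lambda\in B\}$; the set $B(I)$ of partition Borel generators of $I$ is the smallest $B\subseteq P_n$ with $I=\mathrm{Sss}(B)$. The Newton polytope $\mathrm{np}(I)$ of a monomial ideal $I$ is the convex hull in $\mathbb R^n$ of the exponent vectors of its minimal monomial generators. The permutohedron of $a\in\mathbb R^n$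 is $\mathbf P(a_1,\dots,a_n)=\mathrm{conv}\{(a_{\sigma(1)},\dots,a_{\sigma(n)}):\sigma\in\mathfrak S_n\}$. *)

theory Defs
  imports "HOL-Analysis.Analysis" "HOL-Library.Poly_Mapping"
begin

text \<open>
  The index set $\{1 < \dots < n\}$ is a finite linearly ordered type \<open>'n\<close>. Exponent vectors are
  \<open>'n \<Rightarrow>\<^sub>0 nat\<close>, and the polynomial ring $R = K[x_1,\dots,x_n]$ is the monoid algebra
  \<open>('n \<Rightarrow>\<^sub>0 nat) \<Rightarrow>\<^sub>0 'k\<close> with the convolution product of \<^theory>\<open>HOL-Library.Poly_Mapping\<close>.
\<close>

type_synonym ('n, 'k) mpoly = "('n \<Rightarrow>\<^sub>0 nat) \<Rightarrow>\<^sub>0 'k"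

definition xpow :: "('n \<Rightarrow>\<^sub>0 nat) \<Rightarrow> ('n, 'k::field) mpoly" where
  "xpow a = Poly_Mapping.single a 1"

definition exponent_vec :: "('n::finite \<Rightarrow>\<^sub>0 nat) \<Rightarrow> real ^ 'n" where
  "exponent_vec a = (\<chi> i. real (Poly_Mapping.lookup a i))"

text \<open>
  The action of the symmetric group, whose elements are the bijections \<open>\<sigma> :: 'n \<Rightarrow> 'n\<close>:
  $\sigma$ sends $x_i$ to $x_{\sigma(i)}$, hence $x^a$ to $x^{\sigma a}$ with
  $(\sigma a)_i = a_{\sigma^{-1}(i)}$. The functions below are meant for bijective \<open>\<sigma>\<close> only.
\<close>

definition perm_exp :: "('n \<Rightarrow> 'n) \<Rightarrow> ('n \<Rightarrow>\<^sub>0 nat) \<Rightarrow> ('n \<Rightarrow>\<^sub>0 nat)" where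
  "perm_exp \<sigma> a = Poly_Mapping.map_key (inv \<sigma>) a"

definition perm_poly :: "('n \<Rightarrow> 'n) \<Rightarrow> ('n, 'k::field) mpoly \<Rightarrow> ('n, 'k) mpoly" where
  "perm_poly \<sigma> p =
     (\<Sum>a\<in>Poly_Mapping.keys p. Poly_Mapping.single (perm_exp \<sigma> a) (Poly_Mapping.lookup p a))"

definition perm_vec :: "('n \<Rightarrow> 'n) \<Rightarrow> real ^ 'n \<Rightarrow> real ^ 'n" where
  "perm_vec \<sigma> v = (\<chi> i. v $ inv \<sigma> i)"

lemma lookup_perm_exp:
  assumes "bij \<sigma>"
  shows "Poly_Mapping.lookup (perm_exp \<sigma> a) i = Poly_Mapping.lookup a (inv \<sigma> i)"
  using bij_imp_bij_inv[OF assms]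
  by (simp add: perm_exp_def map_key.rep_eq bij_is_inj)

lemma perm_poly_xpow: "perm_poly \<sigma> (xpow a) = xpow (perm_exp \<sigma> a)"
  by (simp add: perm_poly_def xpow_def)

lemma perm_exp_single:
  assumes "bij \<sigma>"
  shows "perm_exp \<sigma> (Poly_Mapping.single i k) = Poly_Mapping.single (\<sigma> i) k"
  by (rule poly_mapping_eqI)
    (auto simp: lookup_perm_exp[OF assms] lookup_single when_def bij_inv_eq_iff[OF assms]
      inv_f_f[OF bij_is_inj[OF assms]])

lemma perm_vec_exponent_vec:
  assumes "bij \<sigma>"
  shows "perm_vec \<sigma> (exponent_vec a) = exponent_vec (perm_exp \<sigma> a)"
  by (simp add: perm_vec_def exponent_vec_def lookup_perm_exp[OF assms] vec_eq_iff)

text \<open>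
  Ideals of $R$ are the submodules of $R$ regarded as a module over itself, so
  \<open>module.span (*)\<close> yields the generated ideal.
\<close>

definition monomial_ideal_of :: "('n \<Rightarrow>\<^sub>0 nat) set \<Rightarrow> ('n, 'k::field) mpoly set" where
  "monomial_ideal_of A = module.span (*) (xpow ` A)"

definition monomial_ideal :: "('n, 'k::field) mpoly set \<Rightarrow> bool" where
  "monomial_ideal I \<longleftrightarrow> (\<exists>A. I = monomial_ideal_of A)"

definition symmetric_fixed :: "('n, 'k::field) mpoly set \<Rightarrow> bool" where
  "symmetric_fixed I \<longleftrightarrow> (\<forall>\<sigma>. bij \<sigma> \<longrightarrow> perm_poly \<sigma> ` I = I)"

text \<open>Partitions are weakly \<^emph>\<open>increasing\<close> exponent vectors.\<close>

definition partitions :: "('n::linorder \<Rightarrow>\<^sub>0 nat) set" where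
  "partitions = {l. mono (Poly_Mapping.lookup l)}"

definition partitions_in :: "('n::linorder, 'k::field) mpoly set \<Rightarrow> ('n \<Rightarrow>\<^sub>0 nat) set" where
  "partitions_in I = {l \<in> partitions. xpow l \<in> I}"

text \<open>
  In the exponent of $x^\lambda x_i / x_j$ below, the subtraction (truncated on \<^typ>\<open>nat\<close>) is
  exact, because $\lambda_j > \lambda_i \ge 0$.
\<close>

definition symm_strongly_shifted :: "('n::linorder, 'k::field) mpoly set \<Rightarrow> bool" where
  "symm_strongly_shifted I \<longleftrightarrow>
     monomial_ideal I \<and> symmetric_fixed I \<and>
     (\<forall>l\<in>partitions_in I. \<forall>i j. i < j \<and> Poly_Mapping.lookup l i < Poly_Mapping.lookup l j \<longrightarrow>
        xpow (l + Poly_Mapping.single i 1 - Poly_Mapping.single j 1) \<in> I)"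

text \<open>
  On sets, \<^term>\<open>LEAST X. Q X\<close> denotes the smallest set with property \<open>Q\<close> with respect to
  inclusion.
\<close>

definition Sss :: "('n::linorder \<Rightarrow>\<^sub>0 nat) set \<Rightarrow> ('n, 'k::field) mpoly set" where
  "Sss B = (LEAST I. symm_strongly_shifted I \<and> xpow ` B \<subseteq> I)"

definition partition_borel_gens ::
    "('n::linorder, 'k::field) mpoly set \<Rightarrow> ('n \<Rightarrow>\<^sub>0 nat) set" where
  "partition_borel_gens I = (LEAST B. B \<subseteq> partitions \<and> I = Sss B)"

text \<open>
  The exponents of the minimal monomial generators of a monomial ideal: its smallest generating
  set consisting of monomials.
\<close>

definition minimal_gens :: "('n, 'k::field) mpoly set \<Rightarrow> ('n \<Rightarrow>\<^sub>0 nat) set" where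
  "minimal_gens I = (LEAST A. I = monomial_ideal_of A)"

definition newton_polytope :: "('n::finite, 'k::field) mpoly set \<Rightarrow> (real ^ 'n) set" where
  "newton_polytope I = convex hull (exponent_vec ` minimal_gens I)"

definition permutohedron :: "real ^ 'n \<Rightarrow> (real ^ 'n) set" where
  "permutohedron a = convex hull {(\<chi> i. a $ \<sigma> i) | \<sigma>. bij \<sigma>}"

end

theory Submission
  imports Defs
begin

text \<open>
  A symmetric strongly shifted ideal is determined by its set of exponents, which is closed under
  addition of exponents, permutations, and shifts. A shift $a \mapsto a + e_i - e_j$ with
  $a_i < a_j$ keeps the degree and either lowers $\sum a_k^2$ or is a transposition. So
  $\mu \in \mathrm{Sss}(\lambda)$ is a well-founded partial order on partitions, and $B(I)$
  consists of the minimal elements of $P(I)$. Permutations of these are minimal generators, which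
  gives one inclusion. For the other, induction shows that every exponent of $I$ is componentwise
  at least some exponent of $I$ lying in the convex hull of the permutohedra: the shift of a point
  $b$ lies on the segment from $b$ to its image under a transposition, and a permutation acts
  linearly. A minimal generator must equal the exponent below it.
\<close>

section \<open>Monomial ideals as sets of exponents\<close>

definition exponents :: "('n, 'k::field) mpoly set \<Rightarrow> ('n \<Rightarrow>\<^sub>0 nat) set" where
  "exponents I = {a. xpow a \<in> I}"

text \<open>For an \<open>add_closed\<close> set \<open>U\<close> this is the monomial ideal with
  exponent set \<open>U\<close>. The encoding lets the Least-definitions of the ideals be treated as
  statements about sets of exponents.\<close>

definition monomial_span :: "('n \<Rightarrow>\<^sub>0 nat) set \<Rightarrow> ('n, 'k::field) mpoly set" where
  "monomial_span U = {p. Poly_Mapping.keys p \<subseteq> U}"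

definition up_closure :: "('n \<Rightarrow>\<^sub>0 nat) set \<Rightarrow> ('n \<Rightarrow>\<^sub>0 nat) set" where
  "up_closure A = {a + c | a c. a \<in> A}"

definition add_closed :: "('n \<Rightarrow>\<^sub>0 nat) set \<Rightarrow> bool" where
  "add_closed U \<longleftrightarrow> (\<forall>a\<in>U. \<forall>c. a + c \<in> U)"

definition perm_closed :: "('n \<Rightarrow>\<^sub>0 nat) set \<Rightarrow> bool" where
  "perm_closed U \<longleftrightarrow> (\<forall>a\<in>U. \<forall>\<sigma>. bij \<sigma> \<longrightarrow> perm_exp \<sigma> a \<in> U)"

definition shift_exp :: "'n \<Rightarrow> 'n \<Rightarrow> ('n \<Rightarrow>\<^sub>0 nat) \<Rightarrow> ('n \<Rightarrow>\<^sub>0 nat)" where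
  "shift_exp i j a = a + Poly_Mapping.single i 1 - Poly_Mapping.single j 1"

text \<open>Ranging over all exponents and all pairs makes the condition invariant under relabelling
  variables. For \<open>perm_closed\<close> sets it agrees with the condition on partitions with
  \<open>i < j\<close>, as \<open>symm_strongly_shifted_iff\<close> shows.\<close>

definition shift_closed :: "('n \<Rightarrow>\<^sub>0 nat) set \<Rightarrow> bool" where
  "shift_closed U \<longleftrightarrow>
     (\<forall>a\<in>U. \<forall>i j. Poly_Mapping.lookup a i < Poly_Mapping.lookup a j \<longrightarrow> shift_exp i j a \<in> U)"

lemma module_mult: "module ((*) :: 'a::comm_ring_1 \<Rightarrow> 'a \<Rightarrow> 'a)"
  by unfold_locales (simp_all add: algebra_simps)

lemma keys_xpow [simp]: "Poly_Mapping.keys (xpow a :: ('n, 'k::field) mpoly) = {a}"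
  by (simp add: xpow_def)

lemma poly_mapping_sum_single:
  "(\<Sum>a\<in>Poly_Mapping.keys p. Poly_Mapping.single a (Poly_Mapping.lookup p a)) = p"
  by (rule poly_mapping_eqI)
    (auto simp: lookup_sum lookup_single when_def in_keys_iff sum.delta')

lemma exponents_monomial_span [simp]:
  "exponents (monomial_span U :: ('n, 'k::field) mpoly set) = U"
  by (simp add: exponents_def monomial_span_def)

lemma add_closed_up_closure: "add_closed (up_closure A)"
  by (force simp: add_closed_def up_closure_def add.assoc)

lemma up_closure_superset: "A \<subseteq> up_closure A"
  by (force simp: up_closure_def intro: exI[of _ 0])

lemma up_closure_eq: "add_closed U \<Longrightarrow> up_closure U = U"
  using up_closure_superset[of U] by (force simp: up_closure_def add_closed_def)

text \<open>The right side is a subspace because keys of a product are sums of keys. Conversely, a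
  polynomial is the sum of its terms, and each term is a multiple of some generator.\<close>

lemma monomial_ideal_of_eq:
  "(monomial_ideal_of A :: ('n, 'k::field) mpoly set) = monomial_span (up_closure A)"
proof -
  interpret R: module "(*) :: ('n, 'k) mpoly \<Rightarrow> _"
    by (rule module_mult)
  have "R.span (xpow ` A) \<subseteq> monomial_span (up_closure A)"
  proof (rule R.span_minimal)
    show "xpow ` A \<subseteq> (monomial_span (up_closure A) :: ('n, 'k) mpoly set)"
      using up_closure_superset[of A] by (auto simp: monomial_span_def)
    show "R.subspace (monomial_span (up_closure A))"
    proof (rule R.subspaceI)
      show "0 \<in> (monomial_span (up_closure A) :: ('n, 'k) mpoly set)"
        by (simp add: monomial_span_def)
      show "p + q \<in> monomial_span (up_closure A)"
        if "p \<in> monomial_span (up_closure A)" "q \<in> monomial_span (up_closure A)"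
        for p q :: "('n, 'k) mpoly"
        using that Poly_Mapping.keys_add[of p q] by (auto simp: monomial_span_def)
      show "q * p \<in> monomial_span (up_closure A)" if "p \<in> monomial_span (up_closure A)"
        for p q :: "('n, 'k) mpoly"
      proof -
        have "b + a \<in> up_closure A" if "a \<in> Poly_Mapping.keys p" for a b
          using \<open>p \<in> _\<close> that add_closed_up_closure[of A]
          by (auto simp: monomial_span_def add_closed_def add.commute[of b])
        then show ?thesis
          using keys_mult[of q p] by (force simp: monomial_span_def)
      qed
    qed
  qed
  moreover have "p \<in> R.span (xpow ` A)" if p: "p \<in> monomial_span (up_closure A)" for p
  proof -
    have "Poly_Mapping.single a (Poly_Mapping.lookup p a) \<in> R.span (xpow ` A)"
      if "a \<in> Poly_Mapping.keys p" for a
    proof -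
      from p that have "a \<in> up_closure A"
        by (auto simp: monomial_span_def)
      then obtain b c where bc: "b \<in> A" "a = b + c"
        by (auto simp: up_closure_def)
      have "Poly_Mapping.single c (Poly_Mapping.lookup p a) * xpow b \<in> R.span (xpow ` A)"
        using bc(1) by (intro R.span_scale R.span_base) auto
      then show ?thesis
        by (simp add: xpow_def mult_single bc(2) add.commute)
    qed
    then have "(\<Sum>a\<in>Poly_Mapping.keys p. Poly_Mapping.single a (Poly_Mapping.lookup p a))
        \<in> R.span (xpow ` A)"
      by (rule R.span_sum)
    then show ?thesis
      by (simp only: poly_mapping_sum_single)
  qed
  ultimately show ?thesis
    by (auto simp: monomial_ideal_of_def)
qed

lemma monomial_ideal_iff:
  "monomial_ideal (I :: ('n, 'k::field) mpoly set) \<longleftrightarrow>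
     (\<exists>U. add_closed U \<and> I = monomial_span U)"
  unfolding monomial_ideal_def monomial_ideal_of_eq
  using add_closed_up_closure up_closure_eq by metis

lemma monomial_span_inj:
  "(monomial_span U :: ('n, 'k::field) mpoly set) = monomial_span V \<longleftrightarrow> U = V"
  by (metis exponents_monomial_span)

lemma monomial_span_mono:
  "(monomial_span U :: ('n, 'k::field) mpoly set) \<subseteq> monomial_span V \<longleftrightarrow> U \<subseteq> V"
proof
  assume "(monomial_span U :: ('n, 'k) mpoly set) \<subseteq> monomial_span V"
  then have "exponents (monomial_span U :: ('n, 'k) mpoly set) \<subseteq>
      exponents (monomial_span V :: ('n, 'k) mpoly set)"
    by (auto simp only: exponents_def)
  then show "U \<subseteq> V" by simp
qed (auto simp: monomial_span_def)

section \<open>Permutations acting on exponents and polynomials\<close>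

lemma perm_exp_inv:
  assumes "bij \<sigma>"
  shows "perm_exp (inv \<sigma>) (perm_exp \<sigma> a) = a" "perm_exp \<sigma> (perm_exp (inv \<sigma>) a) = a"
  using assms by (auto intro!: poly_mapping_eqI
     simp: lookup_perm_exp bij_imp_bij_inv inv_inv_eq bij_is_inj bij_is_surj surj_f_inv_f)

lemma perm_exp_comp:
  assumes "bij \<sigma>" "bij \<tau>"
  shows "perm_exp \<sigma> (perm_exp \<tau> a) = perm_exp (\<sigma> \<circ> \<tau>) a"
  using assms
  by (intro poly_mapping_eqI) (simp add: lookup_perm_exp bij_comp o_inv_distrib)

lemma perm_exp_id: "perm_exp id a = a"
  by (intro poly_mapping_eqI) (simp add: lookup_perm_exp)

lemma perm_exp_add:
  assumes "bij \<sigma>"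
  shows "perm_exp \<sigma> (a + b) = perm_exp \<sigma> a + perm_exp \<sigma> b"
  by (rule poly_mapping_eqI) (simp add: lookup_perm_exp[OF assms] lookup_add)

lemma perm_exp_shift_exp:
  assumes "bij \<sigma>"
  shows "perm_exp \<sigma> (shift_exp i j a) = shift_exp (\<sigma> i) (\<sigma> j) (perm_exp \<sigma> a)"
  using assms
  by (intro poly_mapping_eqI)
    (auto simp: shift_exp_def lookup_perm_exp lookup_add lookup_minus lookup_single when_def
      bij_inv_eq_iff bij_is_inj)

lemma lookup_perm_poly:
  assumes "bij \<sigma>"
  shows "Poly_Mapping.lookup (perm_poly \<sigma> p) b = Poly_Mapping.lookup p (perm_exp (inv \<sigma>) b)"
proof -
  have "perm_exp \<sigma> a = b \<longleftrightarrow> a = perm_exp (inv \<sigma>) b" for a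
    using perm_exp_inv[OF assms] by metis
  then show ?thesis
    by (auto simp: perm_poly_def lookup_sum lookup_single when_def in_keys_iff sum.delta')
qed

lemma keys_perm_poly:
  assumes "bij \<sigma>"
  shows "Poly_Mapping.keys (perm_poly \<sigma> p) = perm_exp \<sigma> ` Poly_Mapping.keys p"
proof (intro subset_antisym subsetI)
  fix b
  assume "b \<in> Poly_Mapping.keys (perm_poly \<sigma> p)"
  then have "perm_exp (inv \<sigma>) b \<in> Poly_Mapping.keys p"
    by (simp add: in_keys_iff lookup_perm_poly[OF assms])
  then show "b \<in> perm_exp \<sigma> ` Poly_Mapping.keys p"
    by (rule rev_image_eqI) (simp add: perm_exp_inv[OF assms])
qed (auto simp: in_keys_iff lookup_perm_poly[OF assms] perm_exp_inv[OF assms])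

lemma symmetric_fixed_monomial_span:
  "symmetric_fixed (monomial_span U :: ('n, 'k::field) mpoly set) \<longleftrightarrow> perm_closed U"
proof
  assume L: "symmetric_fixed (monomial_span U :: ('n, 'k) mpoly set)"
  show "perm_closed U"
    unfolding perm_closed_def
  proof (intro ballI allI impI)
    fix a and \<sigma> :: "'n \<Rightarrow> 'n"
    assume "a \<in> U" "bij \<sigma>"
    then have "perm_poly \<sigma> (xpow a) \<in> (monomial_span U :: ('n, 'k) mpoly set)"
      using L by (force simp: symmetric_fixed_def monomial_span_def)
    then show "perm_exp \<sigma> a \<in> U"
      by (simp add: perm_poly_xpow monomial_span_def)
  qed
next
  assume R: "perm_closed U"
  have sub: "perm_poly \<sigma> p \<in> monomial_span U" if "bij \<sigma>" "p \<in> monomial_span U"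
    for \<sigma> and p :: "('n, 'k) mpoly"
    using R that by (auto simp: monomial_span_def keys_perm_poly perm_closed_def)
  \<comment> \<open>Closure of \<open>U\<close> only gives that the image of the ideal lies in the
    ideal; equality comes from applying the inverse permutation.\<close>
  have "p \<in> perm_poly \<sigma> ` monomial_span U" if "bij \<sigma>" "p \<in> monomial_span U"
    for \<sigma> and p :: "('n, 'k) mpoly"
  proof
    show "perm_poly (inv \<sigma>) p \<in> monomial_span U"
      using that by (intro sub bij_imp_bij_inv)
    show "p = perm_poly \<sigma> (perm_poly (inv \<sigma>) p)"
      using that by (intro poly_mapping_eqI)
       (simp add: lookup_perm_poly bij_imp_bij_inv perm_exp_inv inv_inv_eq)
  qed
  with sub show "symmetric_fixed (monomial_span U :: ('n, 'k) mpoly set)"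
    by (auto simp: symmetric_fixed_def)
qed

section \<open>Shifted sets of exponents\<close>

lemma sum_UNIV_remove2:
  fixes g :: "'n::finite \<Rightarrow> 'b::comm_monoid_add"
  assumes "i \<noteq> j"
  shows "sum g UNIV = g i + g j + sum g (UNIV - {i, j})"
proof -
  have "sum g UNIV = sum g {i, j} + sum g (UNIV - {i, j})"
    by (metis finite subset_UNIV sum.subset_diff add.commute)
  with assms show ?thesis by simp
qed

text \<open>A rearrangement maximising the sum of \<open>rank i * value i\<close> is increasing.\<close>

lemma ex_perm_exp_partition:
  fixes a :: "'n::{finite,linorder} \<Rightarrow>\<^sub>0 nat"
  obtains \<sigma> where "bij \<sigma>" "perm_exp \<sigma> a \<in> partitions"
proof -
  define f where "f = Poly_Mapping.lookup a"
  define r :: "'n \<Rightarrow> nat" where "r i = card {..<i}" for i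
  define W where "W \<tau> = (\<Sum>i\<in>UNIV. r i * f (\<tau> i))" for \<tau>
  have fin: "finite (W ` {\<tau>. bij \<tau>})" and ne: "W ` {\<tau>. bij \<tau>} \<noteq> {}"
    using bij_id by (auto simp del: bij_id)
  obtain \<tau> where \<tau>: "bij \<tau>" "W \<tau> = Max (W ` {\<tau>. bij \<tau>})"
    using Max_in[OF fin ne] by auto
  have max: "W \<tau>' \<le> W \<tau>" if "bij \<tau>'" for \<tau>'
    using that fin \<tau>(2) by simp
  have "f (\<tau> i) \<le> f (\<tau> j)" if "i < j" for i j
  proof (rule ccontr)
    assume less: "\<not> f (\<tau> i) \<le> f (\<tau> j)"
    \<comment> \<open>Exchange argument: swapping the two values of an inversion would increase
      \<open>W\<close>.\<close>
    define \<tau>' where "\<tau>' = \<tau> \<circ> Transposition.transpose i j"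
    have r: "r i < r j"
      unfolding r_def using that by (intro psubset_card_mono) auto
    have rest: "(\<Sum>k\<in>UNIV - {i, j}. r k * f (\<tau>' k)) = (\<Sum>k\<in>UNIV - {i, j}. r k * f (\<tau> k))"
      by (intro sum.cong) (auto simp: \<tau>'_def transpose_def)
    have "W \<tau>' = r i * f (\<tau> j) + r j * f (\<tau> i) + (\<Sum>k\<in>UNIV - {i, j}. r k * f (\<tau> k))"
      unfolding W_def using that
      by (subst sum_UNIV_remove2[of i j]) (auto simp: rest, simp add: \<tau>'_def)
    moreover have "W \<tau> = r i * f (\<tau> i) + r j * f (\<tau> j) + (\<Sum>k\<in>UNIV - {i, j}. r k * f (\<tau> k))"
      unfolding W_def using that by (subst sum_UNIV_remove2[of i j]) auto
    \<comment> \<open>Writing both gaps as successors avoids subtraction; the gain of the swap is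
      \<open>Suc x * Suc y\<close>.\<close>
    moreover obtain x where "r j = r i + Suc x"
      using r less_imp_Suc_add by fastforce
    moreover obtain y where "f (\<tau> i) = f (\<tau> j) + Suc y"
      using less less_imp_Suc_add by (metis add_Suc_right not_le)
    ultimately have "W \<tau> < W \<tau>'"
      by (simp add: algebra_simps)
    moreover have "W \<tau>' \<le> W \<tau>"
      using \<tau>(1) by (intro max) (simp add: \<tau>'_def bij_comp)
    ultimately show False by simp
  qed
  \<comment> \<open>\<open>perm_exp\<close> reads entries through the inverse, so
    \<open>inv \<tau>\<close> is what produces the arrangement
    \<open>f \<circ> \<tau>\<close>.\<close>
  then have "perm_exp (inv \<tau>) a \<in> partitions"
    using \<tau>(1)
    by (auto simp: partitions_def mono_def lookup_perm_exp bij_imp_bij_inv inv_inv_eq f_def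
        le_less)
  then show ?thesis
    using that \<tau>(1) bij_imp_bij_inv by blast
qed

text \<open>To shift an arbitrary exponent, sort it first. In the sorted exponent a smaller value
  sits at a smaller index, so the shift is one allowed by the definition, and it commutes with
  undoing the sorting.\<close>

lemma symm_strongly_shifted_iff:
  fixes I :: "('n::{finite,linorder}, 'k::field) mpoly set"
  shows "symm_strongly_shifted I \<longleftrightarrow>
     (\<exists>U. I = monomial_span U \<and> add_closed U \<and> perm_closed U \<and> shift_closed U)"
proof
  assume L: "symm_strongly_shifted I"
  then obtain U where U: "I = monomial_span U" "add_closed U"
    by (auto simp: symm_strongly_shifted_def monomial_ideal_iff)
  have P: "perm_closed U"
    using L U by (simp add: symm_strongly_shifted_def symmetric_fixed_monomial_span)
  have "shift_closed U"
    unfolding shift_closed_def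
  proof (intro ballI allI impI)
    fix a i j
    assume a: "a \<in> U" and less: "Poly_Mapping.lookup a i < Poly_Mapping.lookup a j"
    obtain \<sigma> where \<sigma>: "bij \<sigma>" "perm_exp \<sigma> a \<in> partitions"
      by (rule ex_perm_exp_partition)
    have less': "Poly_Mapping.lookup (perm_exp \<sigma> a) (\<sigma> i) < Poly_Mapping.lookup (perm_exp \<sigma> a) (\<sigma> j)"
      using \<sigma>(1) less by (simp add: lookup_perm_exp bij_is_inj)
    then have "\<sigma> i < \<sigma> j"
      using \<sigma>(2) by (auto simp: partitions_def mono_def) (meson leD le_less_linear)
    moreover have "perm_exp \<sigma> a \<in> partitions_in I"
      using a \<sigma> P by (auto simp: partitions_in_def U(1) monomial_span_def perm_closed_def)
    ultimately have "xpow (shift_exp (\<sigma> i) (\<sigma> j) (perm_exp \<sigma> a)) \<in> I"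
      using L less' by (auto simp: symm_strongly_shifted_def shift_exp_def)
    then have "perm_exp \<sigma> (shift_exp i j a) \<in> U"
      by (simp add: perm_exp_shift_exp[OF \<sigma>(1)] U(1) monomial_span_def)
    then have "perm_exp (inv \<sigma>) (perm_exp \<sigma> (shift_exp i j a)) \<in> U"
      using P \<sigma>(1) bij_imp_bij_inv by (auto simp: perm_closed_def)
    then show "shift_exp i j a \<in> U"
      by (simp add: perm_exp_inv[OF \<sigma>(1)])
  qed
  with U P show "\<exists>U. I = monomial_span U \<and> add_closed U \<and> perm_closed U \<and> shift_closed U"
    by blast
next
  assume "\<exists>U. I = monomial_span U \<and> add_closed U \<and> perm_closed U \<and> shift_closed U"
  then obtain U where U: "I = monomial_span U" "add_closed U" "perm_closed U" "shift_closed U"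
    by blast
  have "symmetric_fixed I" "monomial_ideal I"
    using U symmetric_fixed_monomial_span monomial_ideal_iff by blast+
  moreover have "xpow (a + Poly_Mapping.single i 1 - Poly_Mapping.single j 1) \<in> I"
    if "a \<in> partitions_in I" "Poly_Mapping.lookup a i < Poly_Mapping.lookup a j" for a i j
  proof -
    have "a \<in> U"
      using that(1) unfolding partitions_in_def U(1) by (simp add: monomial_span_def)
    then have "shift_exp i j a \<in> U"
      using U(4) that(2) unfolding shift_closed_def by blast
    then show ?thesis
      unfolding U(1) by (simp add: monomial_span_def shift_exp_def)
  qed
  ultimately show "symm_strongly_shifted I"
    unfolding symm_strongly_shifted_def by blast
qed

section \<open>Closure of a set of exponents and the ideal it describes\<close>

inductive_set shifted_closure :: "('n \<Rightarrow>\<^sub>0 nat) set \<Rightarrow> ('n \<Rightarrow>\<^sub>0 nat) set"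
  for B :: "('n \<Rightarrow>\<^sub>0 nat) set" where
  base: "a \<in> B \<Longrightarrow> a \<in> shifted_closure B"
| add: "a \<in> shifted_closure B \<Longrightarrow> a + c \<in> shifted_closure B"
| perm: "a \<in> shifted_closure B \<Longrightarrow> bij \<sigma> \<Longrightarrow> perm_exp \<sigma> a \<in> shifted_closure B"
| shift: "a \<in> shifted_closure B \<Longrightarrow> Poly_Mapping.lookup a i < Poly_Mapping.lookup a j \<Longrightarrow>
    shift_exp i j a \<in> shifted_closure B"

lemma shifted_closure_closed:
  "add_closed (shifted_closure B)" "perm_closed (shifted_closure B)"
  "shift_closed (shifted_closure B)"
  by (auto simp: add_closed_def perm_closed_def shift_closed_def intro: shifted_closure.intros)

lemma shifted_closure_least:
  assumes "add_closed U" "perm_closed U" "shift_closed U" "B \<subseteq> U"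
  shows "shifted_closure B \<subseteq> U"
proof
  show "a \<in> U" if "a \<in> shifted_closure B" for a
    using that by induction (use assms in \<open>auto simp: add_closed_def perm_closed_def shift_closed_def\<close>)
qed

lemma Sss_eq:
  fixes B :: "('n::{finite,linorder} \<Rightarrow>\<^sub>0 nat) set"
  shows "(Sss B :: ('n, 'k::field) mpoly set) = monomial_span (shifted_closure B)"
  unfolding Sss_def
proof (rule Least_equality)
  show "symm_strongly_shifted (monomial_span (shifted_closure B) :: ('n, 'k) mpoly set) \<and>
      xpow ` B \<subseteq> (monomial_span (shifted_closure B) :: ('n, 'k) mpoly set)"
    using shifted_closure_closed[of B]
    by (auto simp: symm_strongly_shifted_iff monomial_span_inj)
      (auto simp: monomial_span_def shifted_closure.base)
  show "monomial_span (shifted_closure B) \<subseteq> I"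
    if I: "symm_strongly_shifted I \<and> xpow ` B \<subseteq> I" for I :: "('n, 'k) mpoly set"
  proof -
    obtain U where U: "I = monomial_span U" "add_closed U" "perm_closed U" "shift_closed U"
      using I unfolding symm_strongly_shifted_iff by blast
    have "B \<subseteq> U"
      using I unfolding U(1) by (auto simp: monomial_span_def)
    with U show ?thesis
      by (simp add: monomial_span_mono shifted_closure_least)
  qed
qed

text \<open>Each rule has a single premise in the closure, so a derivation is a chain that starts at
  one generator.\<close>

lemma shifted_closure_generator:
  assumes "a \<in> shifted_closure B"
  shows "\<exists>b\<in>B. a \<in> shifted_closure {b}"
  using assms by induction (metis insertI1 shifted_closure.intros)+

lemma shifted_closure_trans:
  assumes "l \<in> shifted_closure {m}" "m \<in> shifted_closure B"
  shows "l \<in> shifted_closure B"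
  using shifted_closure_least[of "shifted_closure B" "{m}"] shifted_closure_closed[of B] assms
  by auto

lemma lookup_shift_exp:
  assumes "Poly_Mapping.lookup a i < Poly_Mapping.lookup a j"
  shows "Poly_Mapping.lookup (shift_exp i j a) k =
    (if k = i then Suc (Poly_Mapping.lookup a i)
     else if k = j then Poly_Mapping.lookup a j - 1 else Poly_Mapping.lookup a k)"
  using assms by (auto simp: shift_exp_def lookup_add lookup_minus lookup_single when_def)

lemma exp_eq_add_diff:
  assumes "\<And>k. Poly_Mapping.lookup b k \<le> Poly_Mapping.lookup a k"
  shows "a = b + (a - b :: 'n \<Rightarrow>\<^sub>0 nat)"
  using assms by (intro poly_mapping_eqI) (simp add: lookup_add lookup_minus)

text \<open>This is the borderline case in which a shift leaves the sum of squares
  unchanged.\<close>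

lemma shift_exp_adjacent:
  assumes "Poly_Mapping.lookup a j = Suc (Poly_Mapping.lookup a i)"
  shows "shift_exp i j a = perm_exp (Transposition.transpose i j) a"
  using assms
  by (intro poly_mapping_eqI) (auto simp: lookup_shift_exp lookup_perm_exp transpose_def)

section \<open>Degree and sum of squares as monotone quantities\<close>

definition exp_degree :: "('n::finite \<Rightarrow>\<^sub>0 nat) \<Rightarrow> nat" where
  "exp_degree a = (\<Sum>i\<in>UNIV. Poly_Mapping.lookup a i)"

definition exp_sumsq :: "('n::finite \<Rightarrow>\<^sub>0 nat) \<Rightarrow> nat" where
  "exp_sumsq a = (\<Sum>i\<in>UNIV. Poly_Mapping.lookup a i * Poly_Mapping.lookup a i)"

lemma exp_degree_add: "exp_degree (a + b) = exp_degree a + exp_degree b"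
  by (simp add: exp_degree_def lookup_add sum.distrib)

lemma exp_degree_eq_0_iff: "exp_degree a = 0 \<longleftrightarrow> a = 0"
  by (auto simp: exp_degree_def poly_mapping_eq_iff fun_eq_iff)

lemma exp_degree_perm: "bij \<sigma> \<Longrightarrow> exp_degree (perm_exp \<sigma> a) = exp_degree a"
  unfolding exp_degree_def
  by (intro sum.reindex_bij_witness[of _ \<sigma> "inv \<sigma>"])
    (auto simp: lookup_perm_exp bij_is_inj bij_is_surj surj_f_inv_f)

lemma exp_sumsq_perm: "bij \<sigma> \<Longrightarrow> exp_sumsq (perm_exp \<sigma> a) = exp_sumsq a"
  unfolding exp_sumsq_def
  by (intro sum.reindex_bij_witness[of _ \<sigma> "inv \<sigma>"])
    (auto simp: lookup_perm_exp bij_is_inj bij_is_surj surj_f_inv_f)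

text \<open>In fixed degree the sum of squares is bounded, so a chain along which it grows must
  stop; \<open>ex_borel_exps\<close> relies on this.\<close>

lemma exp_sumsq_le: "exp_sumsq a \<le> exp_degree a * exp_degree a"
proof -
  have "Poly_Mapping.lookup a i \<le> exp_degree a" for i
    unfolding exp_degree_def by (intro member_le_sum) auto
  then show ?thesis
    unfolding exp_sumsq_def
    by (subst exp_degree_def) (auto simp: sum_distrib_right intro!: sum_mono mult_left_mono)
qed

lemma shift_exp_degree_sumsq:
  assumes less: "Poly_Mapping.lookup a i < Poly_Mapping.lookup a j"
  shows "exp_degree (shift_exp i j a) = exp_degree a"
    and "Suc (Poly_Mapping.lookup a i) < Poly_Mapping.lookup a j \<Longrightarrow>
      exp_sumsq (shift_exp i j a) < exp_sumsq a"
proof -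
  have ij: "i \<noteq> j" using less by auto
  have 1: "(\<Sum>k\<in>UNIV - {i, j}. Poly_Mapping.lookup (shift_exp i j a) k) =
      (\<Sum>k\<in>UNIV - {i, j}. Poly_Mapping.lookup a k)"
    by (intro sum.cong) (auto simp: lookup_shift_exp[OF less])
  show "exp_degree (shift_exp i j a) = exp_degree a"
    unfolding exp_degree_def sum_UNIV_remove2[OF ij] 1
    using less ij by (simp add: lookup_shift_exp[OF less])
  have 2: "(\<Sum>k\<in>UNIV - {i, j}. Poly_Mapping.lookup (shift_exp i j a) k * Poly_Mapping.lookup (shift_exp i j a) k) =
      (\<Sum>k\<in>UNIV - {i, j}. Poly_Mapping.lookup a k * Poly_Mapping.lookup a k)"
    by (intro sum.cong) (auto simp: lookup_shift_exp[OF less])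
  assume "Suc (Poly_Mapping.lookup a i) < Poly_Mapping.lookup a j"
  \<comment> \<open>With this \<open>d\<close> the sum of squares drops by exactly
    \<open>2 * (d + 1)\<close>.\<close>
  then obtain d where d: "Poly_Mapping.lookup a j = Suc (Suc (Poly_Mapping.lookup a i)) + d"
    by (metis Suc_leI le_add_diff_inverse)
  show "exp_sumsq (shift_exp i j a) < exp_sumsq a"
    unfolding exp_sumsq_def sum_UNIV_remove2[OF ij] 2
    using ij by (simp add: lookup_shift_exp[OF less] d algebra_simps)
qed

text \<open>Adding a nonzero exponent raises the degree, a shift across a gap of at least two keeps
  the degree and lowers the sum of squares, and every other rule permutes entries or does
  nothing.\<close>

lemma shifted_closure_singleton_cases:
  assumes "a \<in> shifted_closure {l :: 'n::finite \<Rightarrow>\<^sub>0 nat}"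
  shows "exp_degree l < exp_degree a \<or>
    exp_degree l = exp_degree a \<and> exp_sumsq a < exp_sumsq l \<or>
    (\<exists>\<sigma>. bij \<sigma> \<and> a = perm_exp \<sigma> l)"
  using assms
proof induction
  case (base a)
  then show ?case
    using bij_id perm_exp_id by (metis singletonD)
next
  case (add a c)
  show ?case
  proof (cases "c = 0")
    case False
    then have "exp_degree l \<le> exp_degree a" "exp_degree c > 0"
      using add.IH by (auto simp: exp_degree_perm exp_degree_eq_0_iff[symmetric])
    then show ?thesis
      by (simp add: exp_degree_add)
  qed (use add.IH in simp)
next
  case (perm a \<sigma>)
  then show ?case
    by (auto simp: exp_degree_perm exp_sumsq_perm perm_exp_comp) (metis bij_comp)
next
  case (shift a i j)
  show ?case
  proof (cases "Suc (Poly_Mapping.lookup a i) < Poly_Mapping.lookup a j")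
    case True
    have "exp_degree l < exp_degree a \<or> exp_degree l = exp_degree a \<and> exp_sumsq a \<le> exp_sumsq l"
      using shift.IH by (auto simp: exp_degree_perm exp_sumsq_perm)
    then show ?thesis
      using shift_exp_degree_sumsq[OF shift.hyps(2)] True by auto
  next
    case False
    let ?t = "Transposition.transpose i j"
    have eq: "shift_exp i j a = perm_exp ?t a"
      using False shift.hyps(2) by (intro shift_exp_adjacent) simp
    show ?thesis
      using shift.IH unfolding eq
      by (auto simp: exp_degree_perm exp_sumsq_perm perm_exp_comp) (metis bij_comp bij_transpose)
  qed
qed

text \<open>Both partitions list the same multiset of values in increasing order, and a sorted list
  is determined by its multiset.\<close>

lemma perm_exp_partition_eq:
  fixes l :: "'n::{finite,linorder} \<Rightarrow>\<^sub>0 nat"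
  assumes "bij \<sigma>" "l \<in> partitions" "perm_exp \<sigma> l \<in> partitions"
  shows "perm_exp \<sigma> l = l"
proof -
  define xs where "xs = sorted_list_of_set (UNIV :: 'n set)"
  have xs: "set xs = UNIV" "sorted xs" "mset xs = mset_set UNIV"
    unfolding xs_def by (simp_all, metis mset_sorted_list_of_multiset sorted_list_of_mset_set)
  have sorted: "sorted (map (Poly_Mapping.lookup m) xs)" if "m \<in> partitions" for m
    using that xs(2) by (intro sorted_map_mono) (auto simp: partitions_def mono_on_def mono_def)
  have "image_mset (Poly_Mapping.lookup (perm_exp \<sigma> l)) (mset_set UNIV) =
      image_mset (Poly_Mapping.lookup l) (image_mset (inv \<sigma>) (mset_set UNIV))"
    unfolding multiset.map_comp
    by (intro image_mset_cong) (simp add: lookup_perm_exp[OF assms(1)])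
  also have "image_mset (inv \<sigma>) (mset_set UNIV) = mset_set UNIV"
    using bij_imp_bij_inv[OF assms(1)] by (subst image_mset_mset_set) (auto simp: bij_def)
  finally have "mset (map (Poly_Mapping.lookup (perm_exp \<sigma> l)) xs) = mset (map (Poly_Mapping.lookup l) xs)"
    by (simp add: xs(3))
  then have "map (Poly_Mapping.lookup (perm_exp \<sigma> l)) xs = map (Poly_Mapping.lookup l) xs"
    using sorted[OF assms(2)] sorted[OF assms(3)] by (metis properties_for_sort)
  then show ?thesis
    by (intro poly_mapping_eqI) (simp add: xs(1))
qed

section \<open>Minimal generators and partition Borel generators\<close>

text \<open>Divisibility of monomials is written additively as \<open>a = b + c\<close>.\<close>

definition min_exps :: "('n \<Rightarrow>\<^sub>0 nat) set \<Rightarrow> ('n \<Rightarrow>\<^sub>0 nat) set" where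
  "min_exps U = {a \<in> U. \<forall>b\<in>U. \<forall>c. a = b + c \<longrightarrow> b = a}"

text \<open>Minimal partitions of \<open>U\<close> when \<open>m\<close> is placed below
  \<open>l\<close> if \<open>l \<in> shifted_closure {m}\<close>.\<close>

definition borel_exps :: "('n::linorder \<Rightarrow>\<^sub>0 nat) set \<Rightarrow> ('n \<Rightarrow>\<^sub>0 nat) set" where
  "borel_exps U = {l \<in> partitions \<inter> U.
     \<forall>m\<in>partitions \<inter> U. l \<in> shifted_closure {m} \<longrightarrow> m = l}"

lemma up_closure_min_exps:
  fixes U :: "('n::finite \<Rightarrow>\<^sub>0 nat) set"
  assumes "add_closed U"
  shows "up_closure (min_exps U) = U"
proof
  show "up_closure (min_exps U) \<subseteq> U"
    using assms by (auto simp: up_closure_def min_exps_def add_closed_def)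
  have "a \<in> up_closure (min_exps U)" if "a \<in> U" for a
    using that
  proof (induction "exp_degree a" arbitrary: a rule: less_induct)
    case less
    show ?case
    proof (cases "a \<in> min_exps U")
      case True
      then show ?thesis using up_closure_superset by blast
    next
      case False
      then obtain b c where bc: "b \<in> U" "a = b + c" "b \<noteq> a"
        using less.prems by (auto simp: min_exps_def)
      then have "exp_degree b < exp_degree a"
        using exp_degree_eq_0_iff[of c] by (auto simp: exp_degree_add)
      then have "b \<in> up_closure (min_exps U)"
        using bc(1) by (rule less.hyps)
      then show ?thesis
        using add_closed_up_closure bc(2) unfolding add_closed_def by blast
    qed
  qed
  then show "U \<subseteq> up_closure (min_exps U)" by blast
qed

text \<open>A minimal exponent is a multiple of a member of any generating set, hence equal to it,
  so it lies in every generating set.\<close>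

lemma minimal_gens_monomial_span:
  fixes U :: "('n::finite \<Rightarrow>\<^sub>0 nat) set"
  assumes "add_closed U"
  shows "minimal_gens (monomial_span U :: ('n, 'k::field) mpoly set) = min_exps U"
  unfolding minimal_gens_def monomial_ideal_of_eq monomial_span_inj
proof (rule Least_equality)
  show "U = up_closure (min_exps U)"
    using up_closure_min_exps[OF assms] by simp
  show "min_exps U \<subseteq> A" if U: "U = up_closure A" for A
  proof
    fix a
    assume a: "a \<in> min_exps U"
    then obtain b c where "b \<in> A" "a = b + c"
      unfolding min_exps_def U by (auto simp: up_closure_def)
    moreover from this have "b \<in> U"
      using up_closure_superset U by blast
    ultimately show "a \<in> A"
      using a by (auto simp: min_exps_def)
  qed
qed

lemma ex_borel_exps:
  fixes l :: "'n::{finite,linorder} \<Rightarrow>\<^sub>0 nat"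
  assumes "l \<in> partitions \<inter> U"
  shows "\<exists>m\<in>borel_exps U. l \<in> shifted_closure {m}"
  using assms
\<comment> \<open>Going down from \<open>l\<close> lowers the degree, or keeps it and raises the sum
  of squares. The second component turns that bounded growth into a decrease.\<close>
proof (induction l rule: wf_induct_rule[OF wf_measures[of
      "[exp_degree, \<lambda>a. exp_degree a * exp_degree a - exp_sumsq a]"]])
  case (1 l)
  show ?case
  proof (cases "l \<in> borel_exps U")
    case True
    then show ?thesis
      by (auto intro: shifted_closure.base)
  next
    case False
    then obtain m where m: "m \<in> partitions \<inter> U" "l \<in> shifted_closure {m}" "m \<noteq> l"
      using "1.prems" unfolding borel_exps_def by blast
    have "\<not> (\<exists>\<sigma>. bij \<sigma> \<and> l = perm_exp \<sigma> m)"
      using perm_exp_partition_eq[of _ m] m(1,3) "1.prems" by (metis IntD1)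
    then have "exp_degree m < exp_degree l \<or> exp_degree m = exp_degree l \<and> exp_sumsq l < exp_sumsq m"
      using shifted_closure_singleton_cases[OF m(2)] by blast
    then have "(m, l) \<in> measures [exp_degree, \<lambda>a. exp_degree a * exp_degree a - exp_sumsq a]"
      using exp_sumsq_le[of m] by auto
    then obtain m' where "m' \<in> borel_exps U" "m \<in> shifted_closure {m'}"
      using "1.IH" m(1) by blast
    with m(2) show ?thesis
      using shifted_closure_trans by blast
  qed
qed

text \<open>Any exponent of \<open>U\<close> can be sorted, reached from a minimal partition, and
  unsorted again.\<close>

lemma shifted_closure_borel_exps:
  fixes U :: "('n::{finite,linorder} \<Rightarrow>\<^sub>0 nat) set"
  assumes "add_closed U" "perm_closed U" "shift_closed U"
  shows "shifted_closure (borel_exps U) = U"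
proof
  show "shifted_closure (borel_exps U) \<subseteq> U"
    using assms by (intro shifted_closure_least) (auto simp: borel_exps_def)
  show "U \<subseteq> shifted_closure (borel_exps U)"
  proof
    fix a
    assume "a \<in> U"
    obtain \<sigma> where \<sigma>: "bij \<sigma>" "perm_exp \<sigma> a \<in> partitions"
      by (rule ex_perm_exp_partition)
    then have "perm_exp \<sigma> a \<in> partitions \<inter> U"
      using \<open>a \<in> U\<close> assms(2) by (auto simp: perm_closed_def)
    then obtain m where "m \<in> borel_exps U" "perm_exp \<sigma> a \<in> shifted_closure {m}"
      using ex_borel_exps by blast
    then have "perm_exp \<sigma> a \<in> shifted_closure (borel_exps U)"
      using shifted_closure.base shifted_closure_trans by blast
    then have "perm_exp (inv \<sigma>) (perm_exp \<sigma> a) \<in> shifted_closure (borel_exps U)"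
      using bij_imp_bij_inv[OF \<sigma>(1)] by (rule shifted_closure.perm)
    then show "a \<in> shifted_closure (borel_exps U)"
      by (simp add: perm_exp_inv[OF \<sigma>(1)])
  qed
qed

lemma borel_exps_minimal:
  assumes "B \<subseteq> partitions" "shifted_closure B = U"
  shows "borel_exps U \<subseteq> B"
proof
  fix l
  assume l: "l \<in> borel_exps U"
  then have "l \<in> shifted_closure B"
    using assms(2) by (auto simp: borel_exps_def)
  then obtain m where m: "m \<in> B" "l \<in> shifted_closure {m}"
    using shifted_closure_generator by blast
  then have "m \<in> partitions \<inter> U"
    using assms shifted_closure.base by blast
  with l m show "l \<in> B"
    unfolding borel_exps_def by blast
qed

lemma partition_borel_gens_monomial_span:
  fixes U :: "('n::{finite,linorder} \<Rightarrow>\<^sub>0 nat) set"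
  assumes "add_closed U" "perm_closed U" "shift_closed U"
  shows "partition_borel_gens (monomial_span U :: ('n, 'k::field) mpoly set) = borel_exps U"
  unfolding partition_borel_gens_def Sss_eq monomial_span_inj
proof (rule Least_equality)
  show "borel_exps U \<subseteq> partitions \<and> U = shifted_closure (borel_exps U)"
    using shifted_closure_borel_exps[OF assms] by (auto simp: borel_exps_def)
qed (use borel_exps_minimal in blast)

text \<open>As \<open>{l}\<close> generates, it contains the smallest generating set, which cannot
  be empty.\<close>

lemma borel_exps_singleton:
  fixes l :: "'n::{finite,linorder} \<Rightarrow>\<^sub>0 nat"
  assumes "l \<in> partitions"
  shows "borel_exps (shifted_closure {l}) = {l}"
proof -
  let ?U = "shifted_closure {l}"
  have "borel_exps ?U \<subseteq> {l}"
    using assms by (intro borel_exps_minimal) auto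
  moreover have "borel_exps ?U \<noteq> {}"
    using ex_borel_exps[of l ?U] assms shifted_closure.base[of l "{l}"] by auto
  ultimately show ?thesis by blast
qed

section \<open>Newton polytopes\<close>

text \<open>The definition composes with \<open>\<sigma>\<close> while the action uses its inverse;
  over all bijections both give the same set of points.\<close>

lemma permutohedron_exponent_vec:
  fixes l :: "'n::finite \<Rightarrow>\<^sub>0 nat"
  shows "permutohedron (exponent_vec l) = convex hull {exponent_vec (perm_exp \<sigma> l) | \<sigma>. bij \<sigma>}"
proof -
  have "{(\<chi> i. exponent_vec l $ \<sigma> i) | \<sigma>. bij \<sigma>} = {exponent_vec (perm_exp \<sigma> l) | \<sigma>. bij \<sigma>}"
  proof (intro subset_antisym subsetI; elim CollectE exE conjE)
    fix x :: "real ^ 'n" and \<sigma> :: "'n \<Rightarrow> 'n"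
    assume "x = (\<chi> i. exponent_vec l $ \<sigma> i)" "bij \<sigma>"
    then have "x = exponent_vec (perm_exp (inv \<sigma>) l)" "bij (inv \<sigma>)"
      by (simp_all add: exponent_vec_def vec_eq_iff lookup_perm_exp bij_imp_bij_inv inv_inv_eq)
    then show "x \<in> {exponent_vec (perm_exp \<sigma> l) | \<sigma>. bij \<sigma>}" by blast
  next
    fix x :: "real ^ 'n" and \<sigma> :: "'n \<Rightarrow> 'n"
    assume "x = exponent_vec (perm_exp \<sigma> l)" "bij \<sigma>"
    then have "x = (\<chi> i. exponent_vec l $ (inv \<sigma>) i)" "bij (inv \<sigma>)"
      by (simp_all add: exponent_vec_def vec_eq_iff lookup_perm_exp bij_imp_bij_inv)
    then show "x \<in> {(\<chi> i. exponent_vec l $ \<sigma> i) | \<sigma>. bij \<sigma>}" by blast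
  qed
  then show ?thesis
    by (simp add: permutohedron_def)
qed

lemma convex_hull_UN_hull:
  "convex hull (\<Union>l\<in>B. convex hull (S l)) = convex hull (\<Union>l\<in>B. S l)"
proof
  show "convex hull (\<Union>l\<in>B. convex hull (S l)) \<subseteq> convex hull (\<Union>l\<in>B. S l)"
    by (intro hull_minimal UN_least hull_mono) auto
  show "convex hull (\<Union>l\<in>B. S l) \<subseteq> convex hull (\<Union>l\<in>B. convex hull (S l))"
    by (intro hull_mono UN_mono hull_subset) auto
qed

section \<open>Convexity, permutations of coordinates and shifts\<close>

lemma linear_perm_vec: "linear (perm_vec \<sigma>)"
  by (rule linearI) (simp_all add: perm_vec_def vec_eq_iff)

lemma perm_vec_convex_hull:
  assumes "x \<in> convex hull V" "\<And>v. v \<in> V \<Longrightarrow> perm_vec \<sigma> v \<in> V"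
  shows "perm_vec \<sigma> x \<in> convex hull V"
proof -
  have "perm_vec \<sigma> x \<in> convex hull (perm_vec \<sigma> ` V)"
    using assms(1) by (simp add: convex_hull_linear_image[OF linear_perm_vec, symmetric])
  also have "\<dots> \<subseteq> convex hull V"
    using assms(2) by (intro hull_mono) auto
  finally show ?thesis .
qed

lemma exponent_vec_shift_exp:
  assumes less: "Poly_Mapping.lookup b i < Poly_Mapping.lookup b j"
    and V: "convex V" "exponent_vec b \<in> V" "perm_vec (Transposition.transpose i j) (exponent_vec b) \<in> V"
  shows "exponent_vec (shift_exp i j b) \<in> V"
proof -
  \<comment> \<open>Moving the fraction \<open>t\<close> towards the transposed point changes the
    entries at \<open>i\<close> and \<open>j\<close> by exactly one; \<open>t \<le> 1\<close>
    because the integer gap is at least one.\<close>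
  define t where "t = 1 / (real (Poly_Mapping.lookup b j) - real (Poly_Mapping.lookup b i))"
  have t: "0 \<le> t" "t \<le> 1" "t * real (Poly_Mapping.lookup b j) = t * real (Poly_Mapping.lookup b i) + 1"
    using less by (auto simp: t_def field_simps)
  have "exponent_vec (shift_exp i j b) = (1 - t) *\<^sub>R exponent_vec b +
      t *\<^sub>R perm_vec (Transposition.transpose i j) (exponent_vec b)"
    using t(3) less
    by (auto simp: vec_eq_iff exponent_vec_def perm_vec_def lookup_shift_exp[OF less]
        transpose_def algebra_simps of_nat_diff)
  then show ?thesis
    using convexD_alt[OF V t(1,2)] by simp
qed

text \<open>Adding an exponent can leave the hull, so the induction carries a divisor
  \<open>b\<close> of \<open>a\<close> inside the hull instead of \<open>a\<close> itself.\<close>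

lemma shifted_closure_dominates_hull:
  fixes B :: "('n::finite \<Rightarrow>\<^sub>0 nat) set"
  defines "V \<equiv> \<Union>l\<in>B. {exponent_vec (perm_exp \<sigma> l) | \<sigma>. bij \<sigma>}"
  assumes "a \<in> shifted_closure B"
  shows "\<exists>b\<in>shifted_closure B. (\<exists>c. a = b + c) \<and> exponent_vec b \<in> convex hull V"
proof -
  have perm_V: "perm_vec \<sigma> x \<in> convex hull V" if "x \<in> convex hull V" "bij \<sigma>"
    for \<sigma> and x :: "real ^ 'n"
    using that(1)
  proof (rule perm_vec_convex_hull)
    fix v
    assume "v \<in> V"
    then obtain l \<tau> where l: "l \<in> B" "bij \<tau>" "v = exponent_vec (perm_exp \<tau> l)"
      by (auto simp: V_def)
    then have "perm_vec \<sigma> v = exponent_vec (perm_exp (\<sigma> \<circ> \<tau>) l)"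
      using that(2)
      by (simp add: perm_vec_exponent_vec perm_exp_comp)
    moreover have "bij (\<sigma> \<circ> \<tau>)"
      using l(2) that(2) by (simp add: bij_comp)
    ultimately show "perm_vec \<sigma> v \<in> V"
      using l(1) unfolding V_def by blast
  qed
  show ?thesis
    using assms(2)
  proof induction
    case (base a)
    have "exponent_vec (perm_exp id a) \<in> V"
      using base bij_id unfolding V_def by blast
    then have "exponent_vec a \<in> V" by (simp only: perm_exp_id)
    then show ?case
      using base by (intro bexI[of _ a] conjI exI[of _ 0] hull_inc shifted_closure.base) auto
  next
    case (add a c)
    then obtain b d where b: "b \<in> shifted_closure B" "a = b + d" "exponent_vec b \<in> convex hull V"
      by blast
    then show ?case
      by (intro bexI[of _ b] conjI exI[of _ "d + c"]) (auto simp: add.assoc)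
  next
    case (perm a \<sigma>)
    then obtain b c where b: "b \<in> shifted_closure B" "a = b + c" "exponent_vec b \<in> convex hull V"
      by blast
    show ?case
    proof (intro bexI conjI exI)
      show "perm_exp \<sigma> a = perm_exp \<sigma> b + perm_exp \<sigma> c"
        by (simp add: b(2) perm_exp_add[OF perm.hyps(2)])
      show "exponent_vec (perm_exp \<sigma> b) \<in> convex hull V"
        using perm_V[OF b(3) perm.hyps(2)] by (simp add: perm_vec_exponent_vec perm.hyps(2))
      show "perm_exp \<sigma> b \<in> shifted_closure B"
        using b(1) perm.hyps(2) by (rule shifted_closure.perm)
    qed
  next
    case (shift a i j)
    then obtain b c where b: "b \<in> shifted_closure B" "a = b + c" "exponent_vec b \<in> convex hull V"
      by blast
    have le: "Poly_Mapping.lookup b k \<le> Poly_Mapping.lookup a k" for k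
      by (simp add: b(2) lookup_add)
    show ?case
    proof (cases "Poly_Mapping.lookup b j < Poly_Mapping.lookup a j")
      case True
      \<comment> \<open>There is room at \<open>j\<close>, so \<open>b\<close> still divides the
        shifted exponent.\<close>
      then have "shift_exp i j a = b + (shift_exp i j a - b)"
        using le by (intro exp_eq_add_diff) (auto simp: lookup_shift_exp[OF shift.hyps(2)] intro: le_SucI)
      with b(1,3) show ?thesis
        by (intro bexI[of _ b] conjI exI)
    next
      case False
      \<comment> \<open>Here \<open>b\<close> and \<open>a\<close> agree at \<open>j\<close>, while
        \<open>b\<close> is at most \<open>a\<close> at \<open>i\<close>, so \<open>b\<close> can be
        shifted along with \<open>a\<close>.\<close>
      then have less: "Poly_Mapping.lookup b i < Poly_Mapping.lookup b j"
        using le[of i] le[of j] shift.hyps(2) by linarith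
      show ?thesis
      proof (intro bexI conjI exI)
        show "shift_exp i j a = shift_exp i j b + (shift_exp i j a - shift_exp i j b)"
          using le
          by (intro exp_eq_add_diff)
            (simp add: lookup_shift_exp[OF shift.hyps(2)] lookup_shift_exp[OF less] diff_le_mono)
        show "exponent_vec (shift_exp i j b) \<in> convex hull V"
          using b(3) by (intro exponent_vec_shift_exp[OF less] perm_V) auto
        show "shift_exp i j b \<in> shifted_closure B"
          using b(1) less by (rule shifted_closure.shift)
      qed
    qed
  qed
qed

text \<open>If \<open>b\<close> divides a permutation of \<open>l\<close>, then \<open>l\<close>
  lies in the closure of the sorted form of \<open>b\<close>. Minimality of \<open>l\<close> makes
  that form equal to \<open>l\<close>, and comparing degrees forces the cofactor to vanish.\<close>

lemma perm_borel_exps_minimal: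
  fixes U :: "('n::{finite,linorder} \<Rightarrow>\<^sub>0 nat) set"
  assumes "perm_closed U" "l \<in> borel_exps U" "bij \<sigma>"
  shows "perm_exp \<sigma> l \<in> min_exps U"
  unfolding min_exps_def
proof (intro CollectI conjI ballI allI impI)
  show "perm_exp \<sigma> l \<in> U"
    using assms by (auto simp: borel_exps_def perm_closed_def)
  fix b c
  assume bc: "b \<in> U" "perm_exp \<sigma> l = b + c"
  obtain \<tau> where \<tau>: "bij \<tau>" "perm_exp \<tau> b \<in> partitions"
    by (rule ex_perm_exp_partition)
  define m where "m = perm_exp \<tau> b"
  have m: "m \<in> partitions \<inter> U"
    using \<tau> bc(1) assms(1) by (auto simp: m_def perm_closed_def)
  have "perm_exp (inv \<tau>) m + c \<in> shifted_closure {m}"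
    using \<tau>(1) by (intro shifted_closure.add shifted_closure.perm shifted_closure.base bij_imp_bij_inv) simp
  then have "perm_exp \<sigma> l \<in> shifted_closure {m}"
    by (simp add: m_def bc(2) perm_exp_inv[OF \<tau>(1)])
  then have "perm_exp (inv \<sigma>) (perm_exp \<sigma> l) \<in> shifted_closure {m}"
    using bij_imp_bij_inv[OF assms(3)] by (rule shifted_closure.perm)
  then have "m = l"
    using assms(2) m unfolding perm_exp_inv[OF assms(3)] borel_exps_def by blast
  then have "exp_degree b = exp_degree (perm_exp \<sigma> l)"
    using \<tau>(1) assms(3) by (auto simp: m_def exp_degree_perm)
  then have "c = 0"
    by (simp add: bc(2) exp_degree_add exp_degree_eq_0_iff)
  with bc(2) show "b = perm_exp \<sigma> l" by simp
qed

lemma newton_polytope_eq: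
  fixes I :: "('n::{finite,linorder}, 'k::field) mpoly set"
  assumes "symm_strongly_shifted I"
  shows "newton_polytope I =
    convex hull (\<Union>l\<in>partition_borel_gens I. permutohedron (exponent_vec l))"
proof -
  obtain U where U: "I = monomial_span U" "add_closed U" "perm_closed U" "shift_closed U"
    using assms unfolding symm_strongly_shifted_iff by blast
  define V where "V = (\<Union>l\<in>borel_exps U. {exponent_vec (perm_exp \<sigma> l) | \<sigma>. bij \<sigma>})"
  have "V \<subseteq> exponent_vec ` min_exps U"
    using perm_borel_exps_minimal[OF U(3)] unfolding V_def by blast
  moreover have "exponent_vec ` min_exps U \<subseteq> convex hull V"
  proof (rule image_subsetI)
    fix a
    assume a: "a \<in> min_exps U"
    then have "a \<in> shifted_closure (borel_exps U)"
      by (simp add: shifted_closure_borel_exps[OF U(2-4)] min_exps_def)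
    then obtain b c where "b \<in> U" "a = b + c" "exponent_vec b \<in> convex hull V"
      using shifted_closure_dominates_hull[of a "borel_exps U"]
      unfolding shifted_closure_borel_exps[OF U(2-4)] V_def by blast
    with a show "exponent_vec a \<in> convex hull V"
      by (auto simp: min_exps_def)
  qed
  ultimately have "convex hull (exponent_vec ` min_exps U) = convex hull V"
    by (metis convex_convex_hull hull_minimal hull_mono subset_antisym)
  then show ?thesis
    unfolding newton_polytope_def permutohedron_exponent_vec convex_hull_UN_hull U(1)
      minimal_gens_monomial_span[OF U(2)] partition_borel_gens_monomial_span[OF U(2-4)] V_def .
qed

theorem proposition3p16:
  shows "(\<forall>l \<in> (partitions :: ('n::{finite,linorder} \<Rightarrow>\<^sub>0 nat) set).
            newton_polytope (Sss {l} :: ('n, 'k::field) mpoly set) = permutohedron (exponent_vec l) \<and>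
            permutohedron (exponent_vec l) = convex hull {perm_vec \<sigma> (exponent_vec l) | \<sigma>. bij \<sigma>}) \<and>
         (\<forall>I :: ('n, 'k) mpoly set. symm_strongly_shifted I \<longrightarrow>
            newton_polytope I =
              convex hull (\<Union>l\<in>partition_borel_gens I. permutohedron (exponent_vec l)))"
proof (intro conjI ballI allI impI)
  fix l :: "'n \<Rightarrow>\<^sub>0 nat"
  assume l: "l \<in> partitions"
  have "symm_strongly_shifted (Sss {l} :: ('n, 'k) mpoly set)"
    using shifted_closure_closed[of "{l}"] unfolding symm_strongly_shifted_iff Sss_eq by blast
  moreover have "partition_borel_gens (Sss {l} :: ('n, 'k) mpoly set) = {l}"
    unfolding Sss_eq partition_borel_gens_monomial_span[OF shifted_closure_closed]
    by (rule borel_exps_singleton[OF l])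
  ultimately have "newton_polytope (Sss {l} :: ('n, 'k) mpoly set) =
      convex hull (permutohedron (exponent_vec l))"
    by (simp add: newton_polytope_eq)
  \<comment> \<open>A permutohedron is already a convex hull, so the outer hull adds
    nothing.\<close>
  then show "newton_polytope (Sss {l} :: ('n, 'k) mpoly set) = permutohedron (exponent_vec l)"
    by (simp add: permutohedron_def)
  have "{perm_vec \<sigma> (exponent_vec l) | \<sigma>. bij \<sigma>} = {exponent_vec (perm_exp \<sigma> l) | \<sigma>. bij \<sigma>}"
    using perm_vec_exponent_vec by metis
  then show "permutohedron (exponent_vec l) = convex hull {perm_vec \<sigma> (exponent_vec l) | \<sigma>. bij \<sigma>}"
    by (simp add: permutohedron_exponent_vec)
qed (rule newton_polytope_eq)

end
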